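(* Let $\lambda\in\mathbb R$ and $\alpha,\beta\in\mathbb R$ with $\tau\bar\tau:=\alpha^2-\lambda\beta^2\neq 0$. Let $A,B,C:\mathfrak g\to\mathfrak g$ be linear maps with $A^t=-A$ and $C^t=-C$, and let $r'$ be the antisymmetric element of $\mathfrak g_\lambda\otimes\mathfrak g_\lambda$ determined by $(A,B,C)$ as in the context. Then $r=r'+K_\tau$ is a compatible $r$-matrix (i.e. satisfies the classical Yang–Baxter equation $[[r,r]]=0$) if $A,B,C$ satisfy the coupled equations \begin{align*} \tfrac12\,\mathrm{tr}(A^2)-\tfrac{\lambda}{2}\big(\mathrm{tr}(B)^2-\mathrm{tr}(B^2)\big)&=\mu\lambda,\\ \mathrm{tr}(CB)&=\nu,\\ (B-\mathrm{tr}(B)\,\mathrm{id})(B+B^t)+\tfrac12\big(\mathrm{tr}(B)^2-\mathrm{tr}(B^2)\big)\mathrm{id}-CA+\lambda\big(C^2-\tfrac12\mathrm{tr}(C^2)\,\mathrm{id}\big)&=-\mu\,\mathrm{id},\\ -A(B+B^t)+(B^t-\mathrm{tr}(B)\,\mathrm{id})(\lambda C-A)-\mathrm{tr}(AB)\,\mathrm{id}&=-\lambda\nu\,\mathrm{id}. \end{align*}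
   Context: Let $\mathfrak g$ denote either $so(3)$ or $so(2,1)$, with basis $J_0,J_1,J_2$ and metric $\eta=\mathrm{diag}(1,1,1)$ (for $so(3)$) or $\eta=\mathrm{diag}(1,-1,-1)$ (for $so(2,1)$); indices are raised and lowered with $\eta$, summation over repeated indices is implied, $\epsilon_{abc}$ is totally antisymmetric with $\epsilon_{012}=\epsilon^{012}=1$, and $[J_a,J_b]=\epsilon_{abc}J^c$. The inner product on $\mathfrak g$ is $\langle J_a,J_b\rangle=\eta_{ab}$. For a linear map $F:\mathfrak g\to\mathfrak g$, $F^t$ denotes its transpose with respect to $\langle\cdot,\cdot\rangle$ (i.e. $\langle v,Fw\rangle=\langle F^tv,w\rangle$); for $v\in\mathfrak g$, $v^t=\langle v,\cdot\rangle$, so $vu^t$ is the map $X\mapsto\langle u,X\rangle v$; $[u,\cdot]$ is the map $X\mapsto[u,X]$; $\mathrm{id}$ is the identity and $\mathrm{tr}$ the trace. For $\lambda\in\mathbb R$, $\mathfrak g_\lambda$ is the real six-dimensional Lie algebra with basis $J_a,P_a$ ($a=0,1,2$) and brackets $[J_a,J_b]=\epsilon_{abc}J^c$, $[J_a,P_b]=\epsilon_{abc}P^c$, $[P_a,P_b]=\lambda\epsilon_{abc}J^c$. For real $\alpha,\beta$ with $\tau\bar\tau:=\alpha^2-\lambda\beta^2\neq0$ set $K_\tau=\frac{\alpha}{\tau\bar\tau}(J_a\otimes P^a+P_a\otimes J^a)-\frac{\beta}{\tau\bar\tau}(\lambda J_a\otimes J^a+P_a\otimes P^a)$ (the Casimir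 of the invariant form $\alpha t+\beta s$, where $t(J_a,P_b)=\eta_{ab}$, $t(J_a,J_b)=t(P_a,P_b)=0$, $s(J_a,J_b)=\eta_{ab}$, $s(J_a,P_b)=0$, $s(P_a,P_b)=\lambda\eta_{ab}$), and $\mu=\frac{\alpha^2+\lambda\beta^2}{(\tau\bar\tau)^2}$, $\nu=-\frac{2\alpha\beta}{(\tau\bar\tau)^2}$. For $r=\sum_i x_i\otimes y_i\in\mathfrak g_\lambda\otimes\mathfrak g_\lambda$ put $r_{12}=\sum_i x_i\otimes y_i\otimes1$, $r_{13}=\sum_i x_i\otimes1\otimes y_i$, $r_{23}=\sum_i1\otimes x_i\otimes y_i$ and $[[r,r]]=[r_{12},r_{13}]+[r_{12},r_{23}]+[r_{13},r_{23}]$; the classical Yang–Baxter equation is $[[r,r]]=0$. An element $r\in\mathfrak g_\lambda\otimes\mathfrak g_\lambda$ is called a compatible $r$-matrix if $r=r'+K_\tau$ with $r'$ antisymmetric and $[[r,r]]=0$ (equivalently $[[r',r']]=-[[K_\tau,K_\tau]]$). Given linear maps $A,B,C:\mathfrak g\to\mathfrak g$ with $A^t=-A$, $C^t=-C$, write $M_{ba}=\langle J_b,M(J_a)\rangle$ for the matrix entries of $M\in\{A,B,C\}$, and define the antisymmetric element $r'=A_{ba}\,J^a\otimes J^b+B_{ba}\,(P^a\otimes J^b-J^b\otimes P^a)+C_{ba}\,P^a\otimes P^b$. *)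

theory Defs
  imports "HOL-Analysis.Analysis"
begin

text \<open>The Lie algebra g (so(3) or so(2,1)) is modelled on real^3, with basis
  J_a = axis a 1 (a :: 3, i.e. a in {0,1,2}).\<close>

datatype galg = so3 | so21

definition eta :: "galg \<Rightarrow> 3 \<Rightarrow> real" where
  "eta g a = (case g of so3 \<Rightarrow> 1 | so21 \<Rightarrow> (if a = 0 then 1 else -1))"

definition eps :: "3 \<Rightarrow> 3 \<Rightarrow> 3 \<Rightarrow> real" where
  "eps a b c =
     (if (a,b,c) \<in> {(0,1,2),(1,2,0),(2,0,1)} then 1
      else if (a,b,c) \<in> {(0,2,1),(2,1,0),(1,0,2)} then -1 else 0)"

definition ginner :: "galg \<Rightarrow> real^3 \<Rightarrow> real^3 \<Rightarrow> real" where
  "ginner g u v = (\<Sum>a\<in>UNIV. eta g a * u$a * v$a)"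

definition Jg :: "3 \<Rightarrow> real^3" where "Jg a = axis a 1"

text \<open>Transpose F^t w.r.t. the inner product: its a-th coordinate is
  eta_aa <F^t v, J_a> = eta_aa <v, F J_a>.\<close>
definition gtransp :: "galg \<Rightarrow> (real^3 \<Rightarrow> real^3) \<Rightarrow> (real^3 \<Rightarrow> real^3)" where
  "gtransp g F v = (\<chi> a. eta g a * ginner g v (F (Jg a)))"

definition gtr :: "(real^3 \<Rightarrow> real^3) \<Rightarrow> real" where
  "gtr F = trace (matrix F)"

definition ment :: "galg \<Rightarrow> (real^3 \<Rightarrow> real^3) \<Rightarrow> 3 \<Rightarrow> 3 \<Rightarrow> real" where
  "ment g M b a = ginner g (Jg b) (M (Jg a))"

text \<open>The six-dimensional Lie algebra g_lambda: elements are coefficient functions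
  on the basis indexed by bool \<times> 3, where (False,a) is J_a and (True,a) is P_a.
  Tensors are coefficient functions on pairs/triples of basis indices.\<close>
type_synonym gidx = "bool \<times> 3"

definition Jl :: "3 \<Rightarrow> gidx \<Rightarrow> real" where "Jl a = (\<lambda>i. if i = (False,a) then 1 else 0)"
definition Pl :: "3 \<Rightarrow> gidx \<Rightarrow> real" where "Pl a = (\<lambda>i. if i = (True,a) then 1 else 0)"
definition Jup :: "galg \<Rightarrow> 3 \<Rightarrow> gidx \<Rightarrow> real" where "Jup g a = (\<lambda>i. eta g a * Jl a i)"
definition Pup :: "galg \<Rightarrow> 3 \<Rightarrow> gidx \<Rightarrow> real" where "Pup g a = (\<lambda>i. eta g a * Pl a i)"

definition brb :: "galg \<Rightarrow> real \<Rightarrow> gidx \<Rightarrow> gidx \<Rightarrow> gidx \<Rightarrow> real" where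
  "brb g lam i j = (case (i, j) of
     ((False,a),(False,b)) \<Rightarrow> (\<lambda>k. \<Sum>c\<in>UNIV. eps a b c * Jup g c k)
   | ((False,a),(True,b)) \<Rightarrow> (\<lambda>k. \<Sum>c\<in>UNIV. eps a b c * Pup g c k)
   | ((True,a),(False,b)) \<Rightarrow> (\<lambda>k. - (\<Sum>c\<in>UNIV. eps b a c * Pup g c k))
   | ((True,a),(True,b)) \<Rightarrow> (\<lambda>k. lam * (\<Sum>c\<in>UNIV. eps a b c * Jup g c k)))"

text \<open>[[r,r]] = [r12,r13] + [r12,r23] + [r13,r23] for r = \<Sum> r^{ij} e_i \<otimes> e_j,
  as a coefficient function on triples of basis indices.\<close>
definition cybe :: "galg \<Rightarrow> real \<Rightarrow> (gidx \<Rightarrow> gidx \<Rightarrow> real) \<Rightarrow> gidx \<Rightarrow> gidx \<Rightarrow> gidx \<Rightarrow> real" where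
  "cybe g lam r m1 m2 m3 =
     (\<Sum>i\<in>UNIV. \<Sum>k\<in>UNIV. r i m2 * r k m3 * brb g lam i k m1)
   + (\<Sum>j\<in>UNIV. \<Sum>k\<in>UNIV. r m1 j * r k m3 * brb g lam j k m2)
   + (\<Sum>j\<in>UNIV. \<Sum>l\<in>UNIV. r m1 j * r m2 l * brb g lam j l m3)"

text \<open>K_tau (Casimir of alpha t + beta s).\<close>
definition Ktau :: "galg \<Rightarrow> real \<Rightarrow> real \<Rightarrow> real \<Rightarrow> gidx \<Rightarrow> gidx \<Rightarrow> real" where
  "Ktau g lam \<alpha> \<beta> = (\<lambda>i j. let tt = \<alpha>^2 - lam * \<beta>^2 in
     (\<Sum>a\<in>UNIV. \<alpha> / tt * (Jl a i * Pup g a j + Pl a i * Jup g a j)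
               - \<beta> / tt * (lam * Jl a i * Jup g a j + Pl a i * Pup g a j)))"

definition mu :: "real \<Rightarrow> real \<Rightarrow> real \<Rightarrow> real" where
  "mu lam \<alpha> \<beta> = (\<alpha>^2 + lam * \<beta>^2) / (\<alpha>^2 - lam * \<beta>^2)^2"

definition nu :: "real \<Rightarrow> real \<Rightarrow> real \<Rightarrow> real" where
  "nu lam \<alpha> \<beta> = - 2 * \<alpha> * \<beta> / (\<alpha>^2 - lam * \<beta>^2)^2"

definition rprime :: "galg \<Rightarrow> (real^3 \<Rightarrow> real^3) \<Rightarrow> (real^3 \<Rightarrow> real^3) \<Rightarrow> (real^3 \<Rightarrow> real^3)
     \<Rightarrow> gidx \<Rightarrow> gidx \<Rightarrow> real" where
  "rprime g A B C = (\<lambda>i j. \<Sum>a\<in>UNIV. \<Sum>b\<in>UNIV.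
       ment g A b a * Jup g a i * Jup g b j
     + ment g B b a * (Pup g a i * Jup g b j - Jup g b i * Pup g a j)
     + ment g C b a * Pup g a i * Pup g b j)"

definition compatible_rmatrix :: "galg \<Rightarrow> real \<Rightarrow> real \<Rightarrow> real \<Rightarrow> (gidx \<Rightarrow> gidx \<Rightarrow> real) \<Rightarrow> bool" where
  "compatible_rmatrix g lam \<alpha> \<beta> r \<longleftrightarrow>
     (\<exists>r'. (\<forall>i j. r' i j = - r' j i) \<and> (\<forall>i j. r i j = r' i j + Ktau g lam \<alpha> \<beta> i j))
     \<and> (\<forall>m1 m2 m3. cybe g lam r m1 m2 m3 = 0)"

end

theory Submission
  imports Defs
begin

text \<open>With \<open>p = \<alpha> / (\<alpha>\<^sup>2 - \<lambda>\<beta>\<^sup>2)\<close> and \<open>q = \<beta> / (\<alpha>\<^sup>2 - \<lambda>\<beta>\<^sup>2)\<close> one has \<open>\<mu> = p\<^sup>2 + \<lambda>q\<^sup>2\<close> and \<open>\<nu> = -2pq\<close>, so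
  everything is polynomial in \<open>p\<close>, \<open>q\<close>, \<open>\<lambda>\<close> and the matrix entries. For antisymmetric \<open>A\<close> and \<open>C\<close>
  the components of \<open>[[r,r]]\<close> with none, one, two or three \<open>P\<close>-indices are, up to contraction with
  \<open>\<epsilon>\<close>, exactly the differences between the two sides of the first, fourth, third and second
  equation, respectively. Hence \<open>[[r,r]]\<close> vanishes as soon as the equations hold.\<close>

lemma sum_UNIV_3: "(\<Sum>i\<in>UNIV. f i) = f (0::3) + f 1 + f 2"
proof -
  \<comment> \<open>Arithmetic in the type \<open>3\<close> is modulo 3, so the enumeration 1, 2, 3
    in \<open>sum_3\<close> is the index set 0, 1, 2.\<close>
  have "(3::3) = 0" by simp
  then show ?thesis
    using sum_3[of f] by (simp only: add_ac)
qed

lemma exhaust_012: fixes a :: 3 obtains "a = 0" | "a = 1" | "a = 2"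
  using exhaust_3[of a] by auto

lemma sum_gidx: "(\<Sum>i\<in>UNIV. f (i::gidx)) = (\<Sum>a\<in>UNIV. f (False, a)) + (\<Sum>a\<in>UNIV. f (True, a))"
proof -
  have "(\<Sum>i\<in>UNIV. f (i::gidx)) = (\<Sum>t\<in>UNIV. \<Sum>a\<in>UNIV. f (t, a))"
    by (simp add: sum.cartesian_product)
  then show ?thesis
    by (simp add: UNIV_bool add.commute)
qed

lemma eps_swap: "eps b a c = - eps a b c"
  by (cases a rule: exhaust_012; cases b rule: exhaust_012; cases c rule: exhaust_012)
     (simp_all add: eps_def)

text \<open>The algebra is graded by parity, J even and P odd, so the type of a bracket is the
  exclusive or of the types of its arguments; \<open>lam\<close> enters only for two odd ones. By
  \<open>eps_swap\<close> the P-J bracket takes the same shape as the others.\<close>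

lemma brb_entry:
  "brb g lam (t, a) (u, b) (w, c) =
     (if w = (t \<noteq> u) then (if t \<and> u then lam else 1) * (eps a b c * eta g c) else 0)"
  by (cases t; cases u)
     (auto simp: brb_def Jup_def Pup_def Jl_def Pl_def eps_swap[of b a]
       if_distrib[of "\<lambda>x. _ * x"] cong: if_cong)

lemma Ktau_entry:
  "Ktau g lam \<alpha> \<beta> (t, a) (u, b) =
     (if a = b then (if t \<noteq> u then \<alpha> else if t then - \<beta> else - (lam * \<beta>))
        / (\<alpha>\<^sup>2 - lam * \<beta>\<^sup>2) * eta g a else 0)"
  by (cases t; cases u; cases a rule: exhaust_012; cases b rule: exhaust_012)
     (simp_all add: Ktau_def Let_def sum_UNIV_3 Jup_def Pup_def Jl_def Pl_def)

text \<open>\<open>ment g M b a\<close> is the matrix entry times \<open>eta g b\<close>; this sign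
  cancels against that of the raised index b, and only \<open>eta g a\<close> survives. In the J-P
  block the two indices trade roles.\<close>

lemma rprime_entry:
  "rprime g A B C (t, a) (u, b) =
     (if t then (if u then eta g a * matrix C $ b $ a else eta g a * matrix B $ b $ a)
      else (if u then - (eta g b * matrix B $ a $ b) else eta g a * matrix A $ b $ a))"
  by (cases t; cases u; cases a rule: exhaust_012; cases b rule: exhaust_012; cases g)
     (simp_all add: rprime_def sum_UNIV_3 Jup_def Pup_def Jl_def Pl_def ment_def ginner_def Jg_def
       matrix_def eta_def axis_def)

text \<open>The adjoint with respect to the metric, that is, the ordinary transpose conjugated by
  the diagonal matrix of \<open>eta\<close>, which is its own inverse.\<close>

definition mtransp :: "galg \<Rightarrow> real^3^3 \<Rightarrow> real^3^3" where
  "mtransp g M = (\<chi> i j. eta g i * eta g j * M $ j $ i)"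

text \<open>The tensor \<open>r' + K\<^sub>\<tau>\<close> for \<open>p\<close> and \<open>q\<close> as above.\<close>

definition rmat ::
  "galg \<Rightarrow> real \<Rightarrow> real \<Rightarrow> real \<Rightarrow> real^3^3 \<Rightarrow> real^3^3 \<Rightarrow> real^3^3 \<Rightarrow> gidx \<Rightarrow> gidx \<Rightarrow> real"
  where
  "rmat g lam p q A B C i j = (case (i, j) of ((t, a), (u, b)) \<Rightarrow>
     (if t then (if u then eta g a * C $ b $ a else eta g a * B $ b $ a)
      else (if u then - (eta g b * B $ a $ b) else eta g a * A $ b $ a))
     + (if a = b then (if t \<noteq> u then p else if t then - q else - (lam * q)) * eta g a else 0))"

text \<open>The sum of the principal 2 by 2 minors, i.e. the second elementary symmetric function of
  the eigenvalues.\<close>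

definition minor_sum :: "real^3^3 \<Rightarrow> real" where
  "minor_sum M = ((trace M)\<^sup>2 - trace (M ** M)) / 2"

text \<open>\<open>res1\<close> to \<open>res4\<close> are left side minus right side of the four
  equations, for matrices and with \<mu>, \<nu> written in \<open>p\<close> and
  \<open>q\<close>.\<close>

definition res1 :: "real \<Rightarrow> real \<Rightarrow> real \<Rightarrow> real^3^3 \<Rightarrow> real^3^3 \<Rightarrow> real" where
  "res1 lam p q A B = trace (A ** A) / 2 - lam * minor_sum B - (p\<^sup>2 + lam * q\<^sup>2) * lam"

definition res2 :: "real \<Rightarrow> real \<Rightarrow> real^3^3 \<Rightarrow> real^3^3 \<Rightarrow> real" where
  "res2 p q B C = trace (C ** B) + 2 * p * q"

definition res3 ::
  "galg \<Rightarrow> real \<Rightarrow> real \<Rightarrow> real \<Rightarrow> real^3^3 \<Rightarrow> real^3^3 \<Rightarrow> real^3^3 \<Rightarrow> real^3^3"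
  where
  "res3 g lam p q A B C = (B ** (B + mtransp g B) - trace B *\<^sub>R (B + mtransp g B))
     + minor_sum B *\<^sub>R mat 1 - C ** A + lam *\<^sub>R (C ** C - (trace (C ** C) / 2) *\<^sub>R mat 1)
     + (p\<^sup>2 + lam * q\<^sup>2) *\<^sub>R mat 1"

definition res4 ::
  "galg \<Rightarrow> real \<Rightarrow> real \<Rightarrow> real \<Rightarrow> real^3^3 \<Rightarrow> real^3^3 \<Rightarrow> real^3^3 \<Rightarrow> real^3^3"
  where
  "res4 g lam p q A B C = - (A ** (B + mtransp g B))
     + (mtransp g B ** (lam *\<^sub>R C - A) - trace B *\<^sub>R (lam *\<^sub>R C - A))
     - trace (A ** B) *\<^sub>R mat 1 - (2 * lam * p * q) *\<^sub>R mat 1"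

lemma mtransp_anti_entry:
  assumes "mtransp g M = - M"
  shows "M $ a $ b = - (eta g a * eta g b * M $ b $ a)"
proof -
  have "mtransp g M $ a $ b = (- M) $ a $ b" using assms by simp
  then show ?thesis by (simp add: mtransp_def)
qed

text \<open>Only the three entries above the diagonal remain free. As rewrite rules these equations
  eliminate the dependent entries, so that the identities below become polynomial identities in
  independent variables. The last one has no sign factor because
  \<open>eta g 1 * eta g 2 = 1\<close> in both signatures.\<close>

lemma anti_entries:
  assumes "mtransp g M = - M"
  shows "M $ 0 $ 0 = 0" "M $ 1 $ 1 = 0" "M $ 2 $ 2 = 0"
    "M $ 1 $ 0 = - (eta g 1 * M $ 0 $ 1)"
    "M $ 2 $ 0 = - (eta g 1 * M $ 0 $ 2)"
    "M $ 2 $ 1 = - M $ 1 $ 2"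
  using mtransp_anti_entry[OF assms, of 0 0] mtransp_anti_entry[OF assms, of 1 1]
    mtransp_anti_entry[OF assms, of 2 2] mtransp_anti_entry[OF assms, of 1 0]
    mtransp_anti_entry[OF assms, of 2 0] mtransp_anti_entry[OF assms, of 2 1]
  by (cases g; simp add: eta_def)+

lemmas res_simps = res1_def res2_def res3_def res4_def minor_sum_def matrix_matrix_mult_def
  trace_def mat_def mtransp_def

context
  fixes g :: galg and A C :: "real^3^3"
  assumes antiA: "mtransp g A = - A" and antiC: "mtransp g C = - C"
begin

lemmas cybe_simps = cybe_def sum_gidx sum_UNIV_3 brb_entry rmat_def eps_def eta_def
  anti_entries[OF antiA] anti_entries[OF antiC] res_simps

text \<open>An antisymmetric tensor plus an invariant symmetric one has a totally antisymmetric
  \<open>cybe\<close>. Its JJJ part lies in the third exterior power of a 3-dimensional space, hence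
  is a multiple of \<open>eps\<close>. The proof expands every index choice in both
  signatures.\<close>

lemma cybe_JJJ:
  "cybe g lam (rmat g lam p q A B C) (False, a) (False, b) (False, c) =
    - (eps a b c * eta g a * eta g b * eta g c * res1 lam p q A B)"
  by (cases a rule: exhaust_012; cases b rule: exhaust_012; cases c rule: exhaust_012; cases g)
     (simp_all add: cybe_simps, simp_all add: field_simps power2_eq_square)

text \<open>Antisymmetry in the two J indices lets \<open>eps\<close> trade them for a single index
  \<open>d\<close>, so the nine independent values form a matrix. The JPJ and PJJ components are its
  cyclic shifts.\<close>

lemma cybe_JJP:
  "cybe g lam (rmat g lam p q A B C) (False, a) (False, b) (True, c) =
    (\<Sum>d\<in>UNIV. eps a b d * eta g d * eta g c * res4 g lam p q A B C $ d $ c)"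
  by (cases a rule: exhaust_012; cases b rule: exhaust_012; cases c rule: exhaust_012; cases g)
     (simp_all add: cybe_simps, simp_all add: algebra_simps power2_eq_square)

lemma cybe_JPJ:
  "cybe g lam (rmat g lam p q A B C) (False, a) (True, b) (False, c) =
    (\<Sum>d\<in>UNIV. eps c a d * eta g d * eta g b * res4 g lam p q A B C $ d $ b)"
  by (cases a rule: exhaust_012; cases b rule: exhaust_012; cases c rule: exhaust_012; cases g)
     (simp_all add: cybe_simps, simp_all add: algebra_simps power2_eq_square)

lemma cybe_PJJ:
  "cybe g lam (rmat g lam p q A B C) (True, a) (False, b) (False, c) =
    (\<Sum>d\<in>UNIV. eps b c d * eta g d * eta g a * res4 g lam p q A B C $ d $ a)"
  by (cases a rule: exhaust_012; cases b rule: exhaust_012; cases c rule: exhaust_012; cases g)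
     (simp_all add: cybe_simps, simp_all add: algebra_simps power2_eq_square)

text \<open>Here the antisymmetric pair contracted with \<open>eps\<close> consists of the two P
  indices; PJP and PPJ are again cyclic shifts.\<close>

lemma cybe_JPP:
  "cybe g lam (rmat g lam p q A B C) (False, a) (True, b) (True, c) =
    (\<Sum>d\<in>UNIV. eps b c d * eta g d * eta g a * res3 g lam p q A B C $ d $ a)"
  by (cases a rule: exhaust_012; cases b rule: exhaust_012; cases c rule: exhaust_012; cases g)
     (simp_all add: cybe_simps, simp_all add: field_simps power2_eq_square)

lemma cybe_PJP:
  "cybe g lam (rmat g lam p q A B C) (True, a) (False, b) (True, c) =
    (\<Sum>d\<in>UNIV. eps c a d * eta g d * eta g b * res3 g lam p q A B C $ d $ b)"
  by (cases a rule: exhaust_012; cases b rule: exhaust_012; cases c rule: exhaust_012; cases g)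
     (simp_all add: cybe_simps, simp_all add: field_simps power2_eq_square)

lemma cybe_PPJ:
  "cybe g lam (rmat g lam p q A B C) (True, a) (True, b) (False, c) =
    (\<Sum>d\<in>UNIV. eps a b d * eta g d * eta g c * res3 g lam p q A B C $ d $ c)"
  by (cases a rule: exhaust_012; cases b rule: exhaust_012; cases c rule: exhaust_012; cases g)
     (simp_all add: cybe_simps, simp_all add: field_simps power2_eq_square)

lemma cybe_PPP:
  "cybe g lam (rmat g lam p q A B C) (True, a) (True, b) (True, c) =
    - (eps a b c * eta g a * eta g b * eta g c * res2 p q B C)"
  by (cases a rule: exhaust_012; cases b rule: exhaust_012; cases c rule: exhaust_012; cases g)
     (simp_all add: cybe_simps, simp_all add: algebra_simps power2_eq_square)

end

lemma cybe_rmat_eq_0: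
  assumes "mtransp g A = - A" "mtransp g C = - C"
    and "res1 lam p q A B = 0" "res2 p q B C = 0"
    and "res3 g lam p q A B C = 0" "res4 g lam p q A B C = 0"
  shows "cybe g lam (rmat g lam p q A B C) m1 m2 m3 = 0"
proof -
  obtain t a u b w c where m: "m1 = (t, a)" "m2 = (u, b)" "m3 = (w, c)"
    by (metis surj_pair)
  show ?thesis
    unfolding m
    by (cases t; cases u; cases w)
       (simp_all add: assms cybe_JJJ[OF assms(1,2)] cybe_JJP[OF assms(1,2)] cybe_JPJ[OF assms(1,2)]
         cybe_PJJ[OF assms(1,2)] cybe_JPP[OF assms(1,2)] cybe_PJP[OF assms(1,2)]
         cybe_PPJ[OF assms(1,2)] cybe_PPP[OF assms(1,2)])
qed

lemma rprime_Ktau_eq_rmat: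
  "rprime g A B C i j + Ktau g lam \<alpha> \<beta> i j =
    rmat g lam (\<alpha> / (\<alpha>\<^sup>2 - lam * \<beta>\<^sup>2)) (\<beta> / (\<alpha>\<^sup>2 - lam * \<beta>\<^sup>2))
      (matrix A) (matrix B) (matrix C) i j"
  by (cases i; cases j) (simp add: rprime_entry Ktau_entry rmat_def)

text \<open>\<open>gtransp\<close> sees \<open>F\<close> only through the images of the basis
  vectors, which are the columns of \<open>matrix F\<close>.\<close>

lemma gtransp_eq_mtransp:
  "gtransp g F v = mtransp g (matrix F) *v v"
  by (cases g) (simp_all add: vec_eq_iff gtransp_def mtransp_def ginner_def Jg_def matrix_def
      matrix_vector_mult_def sum_distrib_left mult_ac)

lemma minus_matrix_vector_mult: "(- M) *v v = - (M *v v)"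
  for M :: "'a::ring_1^'n^'m"
  by (simp add: vec_eq_iff matrix_vector_mult_def sum_negf)

text \<open>The J-J and P-P blocks inherit antisymmetry from \<open>A\<close> and \<open>C\<close>;
  the mixed blocks are negatives of each other by construction.\<close>

lemma rprime_antisym:
  assumes "mtransp g (matrix A) = - matrix A" "mtransp g (matrix C) = - matrix C"
  shows "rprime g A B C i j = - rprime g A B C j i"
proof -
  have eta_sq: "eta g x * eta g x = 1" for x
    by (cases g) (simp_all add: eta_def)
  have flip: "eta g x * M $ y $ x = - (eta g y * M $ x $ y)" if "mtransp g M = - M" for x y M
    using mtransp_anti_entry[OF that, of y x] eta_sq[of x] by (simp add: algebra_simps)
  obtain t a u b where "i = (t, a)" "j = (u, b)"
    by (metis surj_pair)
  then show ?thesis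
    using flip[OF assms(1), of a b] flip[OF assms(2), of a b] by (simp add: rprime_entry)
qed

theorem mainTheorem1:
  fixes g :: galg and lam \<alpha> \<beta> :: real and A B C :: "real^3 \<Rightarrow> real^3"
  assumes tt: "\<alpha>^2 - lam * \<beta>^2 \<noteq> 0"
    and linA: "linear A" and linB: "linear B" and linC: "linear C"
    and antiA: "gtransp g A = (\<lambda>v. - A v)"
    and antiC: "gtransp g C = (\<lambda>v. - C v)"
    and eq1: "gtr (A \<circ> A) / 2 - lam / 2 * ((gtr B)^2 - gtr (B \<circ> B)) = mu lam \<alpha> \<beta> * lam"
    and eq2: "gtr (C \<circ> B) = nu lam \<alpha> \<beta>"
    and eq3: "(\<lambda>v. (B (B v + gtransp g B v) - gtr B *\<^sub>R (B v + gtransp g B v))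
                 + (((gtr B)^2 - gtr (B \<circ> B)) / 2) *\<^sub>R v
                 - C (A v)
                 + lam *\<^sub>R (C (C v) - (gtr (C \<circ> C) / 2) *\<^sub>R v))
              = (\<lambda>v. (- mu lam \<alpha> \<beta>) *\<^sub>R v)"
    and eq4: "(\<lambda>v. - A (B v + gtransp g B v)
                 + (gtransp g B (lam *\<^sub>R C v - A v) - gtr B *\<^sub>R (lam *\<^sub>R C v - A v))
                 - gtr (A \<circ> B) *\<^sub>R v)
              = (\<lambda>v. (- lam * nu lam \<alpha> \<beta>) *\<^sub>R v)"
  shows "compatible_rmatrix g lam \<alpha> \<beta> (\<lambda>i j. rprime g A B C i j + Ktau g lam \<alpha> \<beta> i j)"
proof -
  define p where "p = \<alpha> / (\<alpha>\<^sup>2 - lam * \<beta>\<^sup>2)"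
  define q where "q = \<beta> / (\<alpha>\<^sup>2 - lam * \<beta>\<^sup>2)"
  define MA where "MA = matrix A"
  define MB where "MB = matrix B"
  define MC where "MC = matrix C"
  \<comment> \<open>Linearity identifies each map with multiplication by its matrix, which turns all
    hypotheses into statements about matrices.\<close>
  have app: "A = (*v) MA" "B = (*v) MB" "C = (*v) MC"
    using linA linB linC by (auto simp: MA_def MB_def MC_def fun_eq_iff matrix_works)
  have tr: "gtr ((*v) X \<circ> (*v) Y) = trace (X ** Y)" "gtr ((*v) X) = trace X" for X Y
    by (simp_all add: gtr_def matrix_compose)
  have gt: "gtransp g ((*v) X) v = mtransp g X *v v" for X v
    by (simp add: gtransp_eq_mtransp)
  have mu: "mu lam \<alpha> \<beta> = p\<^sup>2 + lam * q\<^sup>2" and nu: "nu lam \<alpha> \<beta> = - (2 * p * q)"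
    by (simp_all add: mu_def nu_def p_def q_def add_divide_distrib power_divide power2_eq_square)
  have neg: "X = - Y" if "\<And>v. X *v v = - (Y *v v)" for X Y :: "real^3^3"
    using that by (simp add: matrix_eq minus_matrix_vector_mult)
  have anti: "mtransp g MA = - MA" "mtransp g MC = - MC"
    using antiA antiC by (auto intro!: neg simp: app gt fun_eq_iff)
  \<comment> \<open>These rules distribute a matrix expression over its action on \<open>v\<close>,
    so that \<open>res3\<close> and \<open>res4\<close> applied to \<open>v\<close> take the form of
    \<open>eq3\<close> and \<open>eq4\<close> at \<open>v\<close>.\<close>
  note lin = matrix_vector_mult_add_rdistrib matrix_vector_mult_diff_rdistrib
    matrix_vector_mul_assoc[symmetric] scaleR_matrix_vector_assoc[symmetric]
    minus_matrix_vector_mult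
  have "res1 lam p q MA MB = 0"
    using eq1 by (simp add: res1_def minor_sum_def app tr mu)
  moreover have "res2 p q MB MC = 0"
    using eq2 by (simp add: res2_def app tr nu)
  moreover have "res3 g lam p q MA MB MC = 0"
    using fun_cong[OF eq3]
    by (simp add: matrix_eq res3_def minor_sum_def app tr gt mu[symmetric] lin)
  moreover have "res4 g lam p q MA MB MC = 0"
    using fun_cong[OF eq4]
    by (simp add: matrix_eq res4_def app tr gt nu lin)
  ultimately have zero: "cybe g lam (rmat g lam p q MA MB MC) m1 m2 m3 = 0" for m1 m2 m3
    using anti by (intro cybe_rmat_eq_0)
  have r_eq: "(\<lambda>i j. rprime g A B C i j + Ktau g lam \<alpha> \<beta> i j) = rmat g lam p q MA MB MC"
    by (intro ext) (simp only: rprime_Ktau_eq_rmat p_def q_def MA_def MB_def MC_def)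
  show ?thesis
    unfolding compatible_rmatrix_def
  proof (intro conjI exI[of _ "rprime g A B C"] allI)
    show "rprime g A B C i j = - rprime g A B C j i" for i j
      using anti unfolding MA_def MC_def by (rule rprime_antisym)
    show "cybe g lam (\<lambda>i j. rprime g A B C i j + Ktau g lam \<alpha> \<beta> i j) m1 m2 m3 = 0" for m1 m2 m3
      unfolding r_eq by (rule zero)
  qed (rule refl)
qed

end
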